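(* Let $\epsilon\in(0,1]$, let $V,A_1$ be real-valued functions on $[a,b]$, and let $\Phi_0:[a,b]\to\mathbb C^2$ be the initial datum. For any mesh size $h=(b-a)/M$ ($M$ an even positive integer) and any time step $\tau>0$, the first-order time-splitting scheme $S_1$ conserves the discrete mass: for all $n\ge0$, $$\|\Phi^{n+1}\|_{l_2}^2=h\sum_{j=0}^{M-1}|\Phi_j^{n+1}|^2= h\sum_{j=0}^{M-1}|\Phi_j^0|^2=h\sum_{j=0}^{M-1}|\Phi_0(x_j)|^2=\|\Phi^0\|_{l_2}^2 .$$
   Context: $\sigma_1=\begin{pmatrix}0&1\\1&0\end{pmatrix}$, $\sigma_3=\begin{pmatrix}1&0\\0&-1\end{pmatrix}$, $I_2$ is the $2\times2$ identity, $|\cdot|$ is the Euclidean norm on $\mathbb C^2$. Grid: $x_j=a+jh$ $(0\le j\le M-1)$, $\mu_l=2\pi l/(b-a)$ for $-M/2\le l\le M/2-1$. For grid values $U=(U_0,\dots,U_{M-1})$, $U_j\in\mathbb C^2$ (extended periodically, $U_M=U_0$), $\|U\|_{l_2}=\big(h\sum_{j=0}^{M-1}|U_j|^2\big)^{1/2}$ and $\hat U_l=\frac1M\sum_{j=0}^{M-1}U_je^{-i\mu_l(x_j-a)}$. Scheme $S_1$ (for the Dirac equation $i\epsilon\partial_t\Phi=[-i\epsilon\sigma_1\partial_x+\sigma_3+V(x)I_2-A_1(x)\sigma_1]\Phi$ on $(a,b)$ with periodic boundary conditions): $\Phi_j^0=\Phi_0(x_j)$ and, for $n\ge0$, $$\Phi_j^{n,*}=\sum_{l=-M/2}^{M/2-1}e^{\tau(-i\mu_l\sigma_1-\frac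 i\epsilon\sigma_3)}\,\hat\Phi^n_l\,e^{i\mu_l(x_j-a)},\qquad \Phi_j^{n+1}=e^{\tau[-\frac i\epsilon V(x_j)I_2+\frac i\epsilon A_1(x_j)\sigma_1]}\,\Phi_j^{n,*}.$$ *)

theory Defs
  imports "HOL-Analysis.Analysis"
begin

definition sigma1 :: "complex^2^2" where
  "sigma1 = vector [vector [0, 1], vector [1, 0]]"

definition sigma3 :: "complex^2^2" where
  "sigma3 = vector [vector [1, 0], vector [0, - 1]]"

definition mscale :: "complex \<Rightarrow> complex^2^2 \<Rightarrow> complex^2^2" where
  "mscale c A = (\<chi> i k. c * A $ i $ k)"

(* The library's exp and power are not the matrix ones on this type: its multiplication
   is componentwise.  Hence the power series is written with the matrix product. *)
definition matrix_exp :: "complex^2^2 \<Rightarrow> complex^2^2" where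
  "matrix_exp A = (\<Sum>n. inverse (fact n) *\<^sub>R (((**) A) ^^ n) (mat 1))"

(* Grid functions have type nat => complex^2; only their values at j = 0, ..., M - 1
   enter the definitions below, so no periodic extension has to be fixed. *)

definition mesh_size :: "real \<Rightarrow> real \<Rightarrow> nat \<Rightarrow> real" where
  "mesh_size a b M = (b - a) / real M"

definition grid_point :: "real \<Rightarrow> real \<Rightarrow> nat \<Rightarrow> nat \<Rightarrow> real" where
  "grid_point a b M j = a + real j * mesh_size a b M"

definition wave_number :: "real \<Rightarrow> real \<Rightarrow> int \<Rightarrow> real" where
  "wave_number a b l = 2 * pi * of_int l / (b - a)"

definition l2_norm :: "real \<Rightarrow> real \<Rightarrow> nat \<Rightarrow> (nat \<Rightarrow> complex^2) \<Rightarrow> real" where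
  "l2_norm a b M U = sqrt (mesh_size a b M * (\<Sum>j<M. (norm (U j))\<^sup>2))"

definition fourier_coeff ::
  "real \<Rightarrow> real \<Rightarrow> nat \<Rightarrow> (nat \<Rightarrow> complex^2) \<Rightarrow> int \<Rightarrow> complex^2" where
  "fourier_coeff a b M U l =
     (1 / of_nat M) *s
       (\<Sum>j<M. exp (- \<i> * of_real (wave_number a b l * (grid_point a b M j - a))) *s U j)"

definition S1_kinetic ::
  "real \<Rightarrow> real \<Rightarrow> nat \<Rightarrow> real \<Rightarrow> real \<Rightarrow> (nat \<Rightarrow> complex^2) \<Rightarrow> nat \<Rightarrow> complex^2" where
  "S1_kinetic a b M eps tau U j =
     (\<Sum>l\<in>{- (int M div 2)..int M div 2 - 1}.
        exp (\<i> * of_real (wave_number a b l * (grid_point a b M j - a))) *s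
          (matrix_exp (mscale (of_real tau)
             (mscale (- \<i> * of_real (wave_number a b l)) sigma1
               - mscale (\<i> / of_real eps) sigma3))
           *v fourier_coeff a b M U l))"

definition S1_potential ::
  "real \<Rightarrow> real \<Rightarrow> nat \<Rightarrow> real \<Rightarrow> (real \<Rightarrow> real) \<Rightarrow> (real \<Rightarrow> real) \<Rightarrow> real
    \<Rightarrow> (nat \<Rightarrow> complex^2) \<Rightarrow> nat \<Rightarrow> complex^2" where
  "S1_potential a b M eps V A1 tau U j =
     matrix_exp (mscale (of_real tau)
       (mscale (- (\<i> / of_real eps) * of_real (V (grid_point a b M j))) (mat 1)
         + mscale (\<i> / of_real eps * of_real (A1 (grid_point a b M j))) sigma1))
     *v U j"

primrec S1 ::
  "real \<Rightarrow> real \<Rightarrow> nat \<Rightarrow> real \<Rightarrow> (real \<Rightarrow> real) \<Rightarrow> (real \<Rightarrow> real) \<Rightarrow> real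
    \<Rightarrow> (real \<Rightarrow> complex^2) \<Rightarrow> nat \<Rightarrow> nat \<Rightarrow> complex^2" where
  "S1 a b M eps V A1 tau Phi0 0 = (\<lambda>j. Phi0 (grid_point a b M j))"
| "S1 a b M eps V A1 tau Phi0 (Suc n) =
     S1_potential a b M eps V A1 tau (S1_kinetic a b M eps tau (S1 a b M eps V A1 tau Phi0 n))"

end

theory Submission
  imports Defs
begin

text \<open>
  Both factors of the scheme are exponentials of skew-Hermitian matrices. For skew-Hermitian
  \<open>A\<close> the Cauchy product of the series of \<open>exp A v\<close> with its conjugate has \<open>n\<close>-th term
  \<open>\<langle>A\<^sup>n v, v\<rangle> / n!\<close> times the alternating sum of binomial coefficients, so that only \<open>n = 0\<close>
  survives and \<open>exp A\<close> preserves the norm. For the kinetic step this is combined with Parseval's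
  identity for the discrete Fourier transform and its inverse.
\<close>

section \<open>Exponentials of skew-Hermitian matrices\<close>

text \<open>The Hermitian inner product, linear in the first argument. Its complex values, not only
  their real part, are kept so that complex scalars can be pulled out of either argument.\<close>

definition cdot :: "complex^'n \<Rightarrow> complex^'n \<Rightarrow> complex" where
  "cdot x y = (\<Sum>i\<in>UNIV. x $ i * cnj (y $ i))"

lemma cdot_self: "cdot x x = of_real ((norm x)\<^sup>2)"
  by (simp add: cdot_def norm_vec_def L2_set_def sum_nonneg complex_norm_square del: of_real_power)

lemma cdot_sum_left: "cdot (\<Sum>k\<in>K. f k) y = (\<Sum>k\<in>K. cdot (f k) y)"
  by (simp add: cdot_def sum_distrib_right sum.swap[of _ K])

lemma cdot_sum_right: "cdot x (\<Sum>k\<in>K. f k) = (\<Sum>k\<in>K. cdot x (f k))"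
  by (simp add: cdot_def sum_distrib_left sum.swap[of _ K])

lemma cdot_smult: "cdot (c *s x) (d *s y) = c * cnj d * cdot x y"
  by (simp add: cdot_def sum_distrib_left mult_ac)

lemma cdot_scaleR: "cdot (r *\<^sub>R x) (s *\<^sub>R y) = of_real (r * s) * cdot x y"
  by (simp add: cdot_def sum_distrib_left scaleR_conv_of_real[where 'a = complex] mult_ac)

lemma norm_vector_smult: "norm (c *s (x :: complex^'n)) = norm c * norm x"
  by (simp add: norm_vec_def norm_mult L2_set_right_distrib)

definition skew_hermitian :: "complex^'n^'n \<Rightarrow> bool" where
  "skew_hermitian A \<longleftrightarrow> (\<forall>i j. cnj (A $ i $ j) = - A $ j $ i)"

lemma cdot_skew:
  assumes "skew_hermitian A"
  shows "cdot x (A *v y) = - cdot (A *v x) y"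
proof -
  have "cdot x (A *v y) = (\<Sum>i\<in>UNIV. \<Sum>j\<in>UNIV. x $ i * (- A $ j $ i * cnj (y $ j)))"
    using assms by (simp add: cdot_def skew_hermitian_def matrix_vector_mult_def sum_distrib_left)
  also have "\<dots> = (\<Sum>j\<in>UNIV. \<Sum>i\<in>UNIV. x $ i * (- A $ j $ i * cnj (y $ j)))"
    by (rule sum.swap)
  also have "\<dots> = - cdot (A *v x) y"
    by (simp add: cdot_def matrix_vector_mult_def sum_distrib_left sum_negf mult_ac)
  finally show ?thesis .
qed

text \<open>Moving one factor \<open>A\<close> from the right argument to the left costs a sign and
  raises the left power, hence the induction for arbitrary \<open>m\<close>.\<close>

lemma cdot_skew_funpow:
  assumes "skew_hermitian A"
  shows "cdot (((*v) A ^^ m) v) (((*v) A ^^ k) v) = (- 1) ^ k * cdot (((*v) A ^^ (m + k)) v) v"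
proof (induction k arbitrary: m)
  case (Suc k)
  have "cdot (((*v) A ^^ m) v) (((*v) A ^^ Suc k) v)
      = - cdot (((*v) A ^^ Suc m) v) (((*v) A ^^ k) v)"
    by (simp add: cdot_skew[OF assms])
  then show ?case
    by (simp only: Suc.IH) simp
qed simp

text \<open>This is the binomial expansion of (1 + (-1))^n divided by n!.\<close>

lemma sum_alternating_inverse_fact:
  assumes "0 < n"
  shows "(\<Sum>m\<le>n. (- 1) ^ (n - m) * (inverse (fact m) * inverse (fact (n - m)))) = (0 :: real)"
proof -
  have "(\<Sum>m\<le>n. (- 1) ^ (n - m) * (inverse (fact m) * inverse (fact (n - m))))
      = (\<Sum>m\<le>n. of_nat (n choose m) * 1 ^ m * (- 1) ^ (n - m)) / (fact n :: real)"
    unfolding sum_divide_distrib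
    by (intro sum.cong refl) (simp add: binomial_fact field_simps)
  also have "\<dots> = 0"
    unfolding binomial_ring[symmetric] using assms by simp
  finally show ?thesis .
qed

lemma norm_exp_series_skew:
  fixes A :: "complex^'n^'n" and v :: "complex^'n"
  assumes skew: "skew_hermitian A"
    and summ: "summable (\<lambda>n. norm (inverse (fact n) *\<^sub>R ((*v) A ^^ n) v))"
  shows "norm (\<Sum>n. inverse (fact n) *\<^sub>R ((*v) A ^^ n) v) = norm v"
proof -
  define u where "u n = inverse (fact n :: real) *\<^sub>R ((*v) A ^^ n) v" for n
  define w where "w = (\<Sum>n. u n)"
  have "summable u"
    using summ unfolding u_def by (rule summable_norm_cancel)
  then have "u sums w"
    by (simp add: w_def summable_sums)
  then have "(\<lambda>n. u n $ i) sums w $ i" for i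
    by (rule bounded_linear.sums[OF bounded_linear_vec_nth])
  then have w_nth: "w $ i = (\<Sum>n. u n $ i)" for i
    by (simp add: sums_iff)
  have abs: "summable (\<lambda>n. norm (u n $ i))" for i
    using summ unfolding u_def[symmetric]
    by (rule summable_comparison_test'[where N = 0]) (simp add: Finite_Cartesian_Product.norm_nth_le)
  \<comment> \<open>The Cauchy product is one of scalar series, so it is formed in each coordinate;
    summing over \<open>i\<close> afterwards assembles \<open>cdot w w\<close>.\<close>
  have "(\<lambda>n. \<Sum>m\<le>n. u m $ i * cnj (u (n - m) $ i)) sums (w $ i * cnj (w $ i))" for i
  proof -
    have "cnj (w $ i) = (\<Sum>n. cnj (u n $ i))"
      by (simp add: w_nth bounded_linear.suminf[OF bounded_linear_cnj]
          summable_norm_cancel[OF abs])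
    then show ?thesis
      using Cauchy_product_sums[OF abs, of "\<lambda>n. cnj (u n $ i)" i] abs by (simp add: w_nth)
  qed
  then have "(\<lambda>n. \<Sum>i\<in>UNIV. \<Sum>m\<le>n. u m $ i * cnj (u (n - m) $ i)) sums cdot w w"
    unfolding cdot_def by (intro sums_sum)
  moreover have "(\<Sum>i\<in>UNIV. \<Sum>m\<le>n. u m $ i * cnj (u (n - m) $ i)) = (if n = 0 then cdot v v else 0)"
    for n
  proof -
    have "(\<Sum>i\<in>UNIV. \<Sum>m\<le>n. u m $ i * cnj (u (n - m) $ i)) = (\<Sum>m\<le>n. cdot (u m) (u (n - m)))"
      unfolding cdot_def by (rule sum.swap)
    \<comment> \<open>Moving the n - m factors of \<open>A\<close> to the left always leaves the
      total power n, so the inner product does not depend on m and factors out of the sum.\<close>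
    also have "\<dots> = (\<Sum>m\<le>n. of_real ((- 1) ^ (n - m) * (inverse (fact m) * inverse (fact (n - m))))
        * cdot (((*v) A ^^ n) v) v)"
      by (intro sum.cong refl) (simp add: u_def cdot_scaleR cdot_skew_funpow[OF skew])
    also have "\<dots> = of_real (\<Sum>m\<le>n. (- 1) ^ (n - m) * (inverse (fact m) * inverse (fact (n - m))))
        * cdot (((*v) A ^^ n) v) v"
      unfolding of_real_sum sum_distrib_right ..
    also have "\<dots> = (if n = 0 then cdot v v else 0)"
      by (cases "n = 0") (simp_all add: sum_alternating_inverse_fact del: of_real_sum)
    finally show ?thesis .
  qed
  ultimately have "(\<lambda>n. if n = 0 then cdot v v else 0) sums cdot w w"
    by simp
  then have "cdot w w = cdot v v"
    using sums_If_finite_set[of "{0 :: nat}" "\<lambda>_. cdot v v"] by (simp add: sums_iff)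
  then have "(norm w)\<^sup>2 = (norm v)\<^sup>2"
    by (simp only: cdot_self of_real_eq_iff)
  then show ?thesis
    by (simp add: w_def u_def)
qed

text \<open>Left multiplication by \<open>A\<close> is a bounded linear map; with a bound K for it,
  the series is dominated by that of exp K times the norm of the identity matrix.\<close>

lemma summable_norm_matrix_exp_series:
  fixes A :: "complex^'n^'n"
  shows "summable (\<lambda>n. norm (inverse (fact n) *\<^sub>R ((**) A ^^ n) (mat 1)))"
proof -
  have "linear (\<lambda>B :: complex^'n^'n. A ** B)"
    by (rule linearI)
      (simp_all add: matrix_matrix_mult_def vec_eq_iff scaleR_sum_right sum.distrib distrib_left)
  then have "bounded_linear (\<lambda>B :: complex^'n^'n. A ** B)"
    by (simp add: linear_conv_bounded_linear)
  from bounded_linear.nonneg_bounded[OF this]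
  obtain K where "0 \<le> K" and K: "norm (A ** B) \<le> norm B * K" for B :: "complex^'n^'n"
    by blast
  have "norm (((**) A ^^ n) (mat 1)) \<le> K ^ n * norm (mat 1 :: complex^'n^'n)" for n
  proof (induction n)
    case (Suc n)
    have "norm (((**) A ^^ Suc n) (mat 1)) \<le> norm (((**) A ^^ n) (mat 1)) * K"
      by (simp add: K)
    also have "\<dots> \<le> K ^ n * norm (mat 1 :: complex^'n^'n) * K"
      by (intro mult_right_mono Suc.IH \<open>0 \<le> K\<close>)
    finally show ?case
      by (simp add: mult_ac)
  qed simp
  then have "norm (inverse (fact n) *\<^sub>R ((**) A ^^ n) (mat 1))
      \<le> inverse (fact n) * K ^ n * norm (mat 1 :: complex^'n^'n)" for n
    by (simp add: mult.assoc mult_left_mono)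
  then show ?thesis
    using summable_mult2[OF summable_exp[of K], of "norm (mat 1 :: complex^'n^'n)"]
    by - (rule summable_comparison_test'[where N = 0], assumption, simp)
qed

text \<open>Evaluation of a matrix at \<open>v\<close> is bounded and linear, so it passes through
  the exponential series and reduces the claim to the vector series treated above.\<close>

lemma norm_matrix_exp_skew:
  assumes "skew_hermitian A"
  shows "norm (matrix_exp A *v v) = norm v"
proof -
  define P where "P n = inverse (fact n :: real) *\<^sub>R ((**) A ^^ n) (mat 1)" for n
  have bl: "bounded_linear (\<lambda>B :: complex^2^2. B *v v)"
    unfolding linear_conv_bounded_linear[symmetric]
    by (rule linearI)
      (simp_all add: matrix_vector_mult_def vec_eq_iff scaleR_sum_right sum.distrib distrib_right)
  have funpow: "((**) A ^^ n) (mat 1) *v v = ((*v) A ^^ n) v" for n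
    by (induction n) (simp_all flip: matrix_vector_mul_assoc)
  have P_apply: "P n *v v = inverse (fact n) *\<^sub>R ((*v) A ^^ n) v" for n
    unfolding P_def by (simp add: linear_scale[OF bounded_linear.linear[OF bl]] funpow)
  have summ: "summable (\<lambda>n. norm (P n))"
    unfolding P_def by (rule summable_norm_matrix_exp_series)
  obtain K where K: "norm (B *v v) \<le> norm B * K" for B :: "complex^2^2"
    using bounded_linear.bounded[OF bl] by blast
  have "summable (\<lambda>n. norm (P n *v v))"
    using summable_mult2[OF summ, of K] by (rule summable_comparison_test'[where N = 0]) (simp add: K)
  moreover have "matrix_exp A *v v = (\<Sum>n. P n *v v)"
    using bounded_linear.suminf[OF bl summable_norm_cancel[OF summ]]
    by (simp add: matrix_exp_def P_def)
  ultimately show ?thesis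
    using norm_exp_series_skew[OF assms, of v] by (simp add: P_apply)
qed

section \<open>Discrete Fourier transform\<close>

text \<open>Expanding the squared norm gives a sum over pairs of indices, of which orthogonality
  keeps only the diagonal. The index sets are left abstract because modes and grid points exchange
  roles between synthesis and analysis.\<close>

lemma parseval_orthogonal:
  fixes w :: "'l \<Rightarrow> complex^'n" and e :: "'l \<Rightarrow> 'j \<Rightarrow> complex" and c :: real
  assumes "finite L"
    and "\<And>l k. l \<in> L \<Longrightarrow> k \<in> L \<Longrightarrow>
      (\<Sum>j\<in>J. e l j * cnj (e k j)) = (if l = k then of_real c else 0)"
  shows "(\<Sum>j\<in>J. (norm (\<Sum>l\<in>L. e l j *s w l))\<^sup>2) = c * (\<Sum>l\<in>L. (norm (w l))\<^sup>2)"
proof -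
  have "complex_of_real (\<Sum>j\<in>J. (norm (\<Sum>l\<in>L. e l j *s w l))\<^sup>2)
      = (\<Sum>j\<in>J. \<Sum>k\<in>L. \<Sum>l\<in>L. e l j * cnj (e k j) * cdot (w l) (w k))"
    by (simp only: of_real_sum cdot_self[symmetric] cdot_sum_left cdot_sum_right cdot_smult)
  also have "\<dots> = (\<Sum>k\<in>L. \<Sum>l\<in>L. \<Sum>j\<in>J. e l j * cnj (e k j) * cdot (w l) (w k))"
    by (subst sum.swap) (intro sum.cong refl sum.swap)
  also have "\<dots> = (\<Sum>k\<in>L. \<Sum>l\<in>L. if l = k then of_real c * cdot (w l) (w k) else 0)"
    by (intro sum.cong refl) (simp add: assms flip: sum_distrib_right)
  also have "\<dots> = of_real (c * (\<Sum>l\<in>L. (norm (w l))\<^sup>2))"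
    using assms(1) by (simp add: cdot_self sum_distrib_left)
  finally show ?thesis
    by (simp only: of_real_eq_iff)
qed

text \<open>A geometric sum whose ratio \<open>z\<close> satisfies z^M = 1: it vanishes unless z =
  1, which happens exactly when M divides k.\<close>

lemma sum_roots_of_unity:
  assumes "0 < M"
  shows "(\<Sum>j<M. cis (2 * pi * of_int k * real j / real M)) = (if int M dvd k then of_nat M else 0)"
proof -
  define z where "z = cis (2 * pi * of_int k / real M)"
  have pow: "cis (2 * pi * of_int k * real j / real M) = z ^ j" for j
    unfolding z_def Complex.DeMoivre by (rule arg_cong[where f = cis]) simp
  have "z ^ M = 1"
    using assms by (simp add: z_def Complex.DeMoivre cis_multiple_2pi)
  have "z = 1 \<longleftrightarrow> int M dvd k"
  proof
    assume "z = 1"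
    then have "cos (2 * pi * of_int k / real M) = 1"
      by (metis cis.simps(1) one_complex.simps(1) z_def)
    then obtain m :: int where "2 * pi * of_int k / real M = of_int m * 2 * pi"
      by (auto simp: cos_one_2pi_int)
    then have "of_int k = (of_int (int M * m) :: real)"
      using assms by (simp add: field_simps)
    then show "int M dvd k"
      by (metis dvd_triv_left of_int_eq_iff)
  next
    assume "int M dvd k"
    then obtain m where "k = int M * m" ..
    then have "2 * pi * of_int k / real M = 2 * pi * of_int m"
      using assms by simp
    then show "z = 1"
      by (simp only: z_def cis_multiple_2pi Ints_of_int)
  qed
  then show ?thesis
    using \<open>z ^ M = 1\<close> by (cases "z = 1") (simp_all add: pow geometric_sum)
qed

text \<open>The Fourier factor of mode \<open>l\<close> at grid point \<open>j\<close> after the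
  interval length has cancelled; see \<open>exp_wave_number\<close>.\<close>

definition wave :: "nat \<Rightarrow> int \<Rightarrow> nat \<Rightarrow> complex" where
  "wave M l j = cis (2 * pi * of_int l * real j / real M)"

definition modes :: "nat \<Rightarrow> int set" where
  "modes M = {- (int M div 2)..int M div 2 - 1}"

lemma finite_modes [simp]: "finite (modes M)"
  by (simp add: modes_def)

lemma exp_wave_number:
  assumes "a \<noteq> b"
  shows "exp (\<i> * of_real (wave_number a b l * (grid_point a b M j - a))) = wave M l j"
proof -
  have "wave_number a b l * (grid_point a b M j - a) = 2 * pi * of_int l * real j / real M"
    using assms by (simp add: wave_number_def grid_point_def mesh_size_def)
  then show ?thesis
    by (simp add: wave_def cis_conv_exp)
qed

text \<open>The modes lie in a window of at most M consecutive integers, so two of them are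
  congruent modulo M only if they are equal.\<close>

lemma wave_orthogonal_modes:
  assumes "0 < M" "l \<in> modes M" "k \<in> modes M"
  shows "(\<Sum>j<M. wave M l j * cnj (wave M k j)) = (if l = k then of_real (real M) else 0)"
proof -
  have "wave M l j * cnj (wave M k j) = cis (2 * pi * of_int (l - k) * real j / real M)" for j
    by (simp add: wave_def cis_cnj cis_mult algebra_simps diff_divide_distrib)
  moreover have "int M dvd l - k \<longleftrightarrow> l = k"
  proof
    assume "int M dvd l - k"
    moreover have "\<bar>l - k\<bar> < int M"
      using assms by (auto simp: modes_def)
    ultimately show "l = k"
      using zdvd_imp_le[of "int M" "\<bar>l - k\<bar>"] by fastforce
  qed simp
  ultimately show ?thesis
    using sum_roots_of_unity[OF assms(1), of "l - k"] by simp
qed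

text \<open>The dual orthogonality, summed over modes. The double conjugate matches the form
  required by \<open>parseval_orthogonal\<close> for the conjugated waves of the forward
  transform.\<close>

lemma wave_orthogonal_grid:
  assumes "0 < M" "even M" "j < M" "j' < M"
  shows "(\<Sum>l\<in>modes M. cnj (wave M l j) * cnj (cnj (wave M l j')))
    = (if j = j' then of_real (real M) else 0)"
proof -
  define k where "k = int j' - int j"
  have "(\<Sum>l\<in>modes M. cnj (wave M l j) * cnj (cnj (wave M l j')))
      = (\<Sum>l\<in>modes M. cis (2 * pi * of_int k * of_int l / real M))"
    by (intro sum.cong refl)
      (simp add: wave_def k_def cis_cnj cis_mult algebra_simps diff_divide_distrib)
  \<comment> \<open>For even M there are exactly M modes, and shifting them by M/2 gives the range
    0, ..., M - 1. The shift contributes only a phase independent of m.\<close>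
  also have "\<dots> = (\<Sum>m<M. cis (2 * pi * of_int k * of_int (int m - int M div 2) / real M))"
  proof (rule sum.reindex_bij_witness[where i = "\<lambda>m. int m - int M div 2"
        and j = "\<lambda>l. nat (l + int M div 2)"])
    fix l assume "l \<in> modes M"
    then show "nat (l + int M div 2) \<in> {..<M}"
      using assms by (auto simp: modes_def)
  qed (use assms in \<open>auto simp: modes_def\<close>)
  also have "\<dots> = (\<Sum>m<M. cis (- (2 * pi * of_int k * of_int (int M div 2) / real M))
      * cis (2 * pi * of_int k * real m / real M))"
    by (intro sum.cong refl) (simp add: cis_mult algebra_simps diff_divide_distrib)
  also have "\<dots> = cis (- (2 * pi * of_int k * of_int (int M div 2) / real M))
      * (if int M dvd k then of_nat M else 0)"
    by (simp add: sum_roots_of_unity[OF assms(1)] flip: sum_distrib_left)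
  also have "int M dvd k \<longleftrightarrow> j = j'"
  proof
    assume "int M dvd k"
    moreover have "\<bar>k\<bar> < int M"
      using assms by (auto simp: k_def)
    ultimately show "j = j'"
      using zdvd_imp_le[of "int M" "\<bar>k\<bar>"] by (fastforce simp: k_def)
  qed (simp add: k_def)
  \<comment> \<open>The remaining phase is 1 when j = j', since then k = 0; otherwise it multiplies
    0.\<close>
  finally show ?thesis
    by (simp add: k_def)
qed

text \<open>Here the inner sum runs over grid points and the outer one over modes. The squared
  normalisation 1/M^2 meets a factor M from orthogonality, which leaves the 1/M balanced on the
  left.\<close>

lemma parseval_fourier_coeff:
  assumes "a \<noteq> b" "0 < M" "even M"
  shows "real M * (\<Sum>l\<in>modes M. (norm (fourier_coeff a b M U l))\<^sup>2) = (\<Sum>j<M. (norm (U j))\<^sup>2)"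
proof -
  have "fourier_coeff a b M U l = (1 / of_nat M) *s (\<Sum>j<M. cnj (wave M l j) *s U j)" for l
    unfolding fourier_coeff_def exp_wave_number[OF assms(1), symmetric] exp_cnj by simp
  then have "(\<Sum>l\<in>modes M. (norm (fourier_coeff a b M U l))\<^sup>2)
      = (1 / real M)\<^sup>2 * (\<Sum>l\<in>modes M. (norm (\<Sum>j<M. cnj (wave M l j) *s U j))\<^sup>2)"
    by (simp add: norm_vector_smult norm_divide power_mult_distrib power_divide
        flip: sum_divide_distrib)
  also have "\<dots> = (1 / real M)\<^sup>2 * (real M * (\<Sum>j<M. (norm (U j))\<^sup>2))"
    by (subst parseval_orthogonal[where c = "real M"])
      (use wave_orthogonal_grid[OF assms(2,3)] in auto)
  finally show ?thesis
    using assms(2) by (simp add: power2_eq_square)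
qed

section \<open>Mass conservation of the splitting scheme\<close>

lemma S1_kinetic_mass:
  assumes "a \<noteq> b" "0 < M" "even M"
  shows "(\<Sum>j<M. (norm (S1_kinetic a b M eps tau U j))\<^sup>2) = (\<Sum>j<M. (norm (U j))\<^sup>2)"
proof -
  define G where "G l = mscale (of_real tau) (mscale (- \<i> * of_real (wave_number a b l)) sigma1
      - mscale (\<i> / of_real eps) sigma3)" for l
  \<comment> \<open>Since \<open>tau\<close>, \<open>eps\<close> and the wave number are real,
    \<open>G l\<close> is an imaginary combination of real symmetric matrices.\<close>
  have "skew_hermitian (G l)" for l
    by (simp add: skew_hermitian_def G_def mscale_def sigma1_def sigma3_def forall_2)
  note norm_G = norm_matrix_exp_skew[OF this]
  have "S1_kinetic a b M eps tau U j
      = (\<Sum>l\<in>modes M. wave M l j *s (matrix_exp (G l) *v fourier_coeff a b M U l))" for j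
    by (simp only: S1_kinetic_def G_def modes_def exp_wave_number[OF assms(1)])
  \<comment> \<open>Parseval for the synthesis yields the factor M that
    \<open>parseval_fourier_coeff\<close> absorbs, once each exponential is seen to preserve the
    norm of its mode.\<close>
  then have "(\<Sum>j<M. (norm (S1_kinetic a b M eps tau U j))\<^sup>2)
      = real M * (\<Sum>l\<in>modes M. (norm (matrix_exp (G l) *v fourier_coeff a b M U l))\<^sup>2)"
    using wave_orthogonal_modes[OF assms(2)] by (simp add: parseval_orthogonal[where c = "real M"])
  also have "\<dots> = (\<Sum>j<M. (norm (U j))\<^sup>2)"
    by (simp add: norm_G parseval_fourier_coeff[OF assms])
  finally show ?thesis .
qed

text \<open>As \<open>V\<close> and \<open>A1\<close> are real-valued, the exponent is again an
  imaginary combination of real symmetric matrices, so the mass is conserved even pointwise.\<close>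

lemma norm_S1_potential: "norm (S1_potential a b M eps V A1 tau U j) = norm (U j)"
  unfolding S1_potential_def
  by (rule norm_matrix_exp_skew)
    (simp add: skew_hermitian_def mscale_def sigma1_def mat_def forall_2)

lemma S1_mass:
  assumes "a \<noteq> b" "0 < M" "even M"
  shows "(\<Sum>j<M. (norm (S1 a b M eps V A1 tau Phi0 n j))\<^sup>2)
    = (\<Sum>j<M. (norm (Phi0 (grid_point a b M j)))\<^sup>2)"
  by (induction n) (simp_all add: norm_S1_potential S1_kinetic_mass[OF assms])

lemma l2_norm_power2:
  assumes "a \<le> b"
  shows "(l2_norm a b M U)\<^sup>2 = mesh_size a b M * (\<Sum>j<M. (norm (U j))\<^sup>2)"
  using assms by (simp add: l2_norm_def mesh_size_def sum_nonneg)

theorem lemma2p1: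
  fixes a b eps tau h :: real
    and M n :: nat
    and V A1 :: "real \<Rightarrow> real"
    and Phi0 :: "real \<Rightarrow> complex^2"
    and Phi :: "nat \<Rightarrow> nat \<Rightarrow> complex^2"
  assumes "a < b"
    and "0 < eps" and "eps \<le> 1"
    and "0 < M" and "even M"
    and "0 < tau"
    and "h = mesh_size a b M"
    and "Phi = S1 a b M eps V A1 tau Phi0"
  shows "(l2_norm a b M (Phi (Suc n)))\<^sup>2 = h * (\<Sum>j<M. (norm (Phi (Suc n) j))\<^sup>2) \<and>
     h * (\<Sum>j<M. (norm (Phi (Suc n) j))\<^sup>2) = h * (\<Sum>j<M. (norm (Phi 0 j))\<^sup>2) \<and>
     h * (\<Sum>j<M. (norm (Phi 0 j))\<^sup>2) = h * (\<Sum>j<M. (norm (Phi0 (grid_point a b M j)))\<^sup>2) \<and>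
     h * (\<Sum>j<M. (norm (Phi0 (grid_point a b M j)))\<^sup>2) = (l2_norm a b M (Phi 0))\<^sup>2"
proof -
  have "a \<noteq> b" "a \<le> b"
    using assms(1) by auto
  note mass = S1_mass[OF this(1) assms(4,5)] and l2 = l2_norm_power2[OF this(2)]
  show ?thesis
    \<comment> \<open>\<open>mass\<close> is schematic in the time level, so it rewrites the sums at
      levels \<open>Suc n\<close> and 0 alike to that of the initial datum.\<close>
    unfolding assms(7,8) l2 mass by simp
qed

end
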